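(* Let $\mathbb Z_n=\{0,\dots,n-1\}$. Suppose the edge-labeling polynomial $p_f(x_0,\dots,x_{n-1})$ is defined from some function $f:\mathbb Z_n\to\mathbb Z_n$ and $p_f$ is not identically zero. (1) It can be determined from $p_f$ whether or not $f$ has a (necessarily unique) fixed point (that is, if $g:\mathbb Z_n\to\mathbb Z_n$ and $p_g=p_f$, then $f$ has a fixed point if and only if $g$ does). (2) If $f$ has a fixed point, then $G_f$ can be determined from $p_f$ (that is, $p_g=p_f$ implies $G_g=G_f$). (3) If $f$ has a fixed point and $G_f$ is connected, then $f$ and $\Gamma_f$ can be determined from $p_f$ and the fixed point (that is, if $p_g=p_f$ and $g$ has the same fixed point as $f$, then $g=f$). (4) Let $S$ denote the set of functions $f:\mathbb Z_n\to\mathbb Z_n$ such that $f$ has $0$ as its unique fixed point and $G_f$ is connected. The function from $S$ to $\mathbb{Q}[x_0,\dots,x_{n-1}]$ that assigns $p_f$ to $f$ is injective.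
   Context: For $f:\mathbb Z_n\to\mathbb Z_n$, the edge-labeling polynomial of $f$ is $p_f(x_0,\dots,x_{n-1})=\prod_{0\le i<j<n}\left((x_{f(j)}-x_j)^2-(x_{f(i)}-x_i)^2\right)$. The functional digraph $\Gamma_f$ has vertex set $\mathbb Z_n$ and arcs $(i,f(i))$ for $i\in\mathbb Z_n$. $G_f$ is the underlying simple graph of $\Gamma_f$: it has vertex set $\mathbb Z_n$ and the edge $\{i,j\}$, $i\ne j$, exactly when $f(i)=j$ or $f(j)=i$. *)

theory Defs
  imports
    "HOL-Library.Poly_Mapping"
    "HOL-Library.FuncSet"
    "Graph_Theory.Graph_Theory"
begin

text \<open>
  Functions from \<open>{0,\<dots>,n-1}\<close> to itself are taken extensional (\<open>undefined\<close> outside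
  \<open>{..<n}\<close>), so that HOL equality of functions is equality on \<open>{..<n}\<close>.
\<close>

abbreviation self_maps :: "nat \<Rightarrow> (nat \<Rightarrow> nat) set" where
  "self_maps n \<equiv> {..<n} \<rightarrow>\<^sub>E {..<n}"

text \<open>
  A polynomial with rational coefficients in the variables \<open>x\<^sub>0, x\<^sub>1, \<dots>\<close> is a finitely supported
  map from monomials (finitely supported exponent functions) to coefficients; the ring
  structure is the convolution product of \<^theory>\<open>HOL-Library.Poly_Mapping\<close>.
\<close>

type_synonym rat_mpoly = "(nat \<Rightarrow>\<^sub>0 nat) \<Rightarrow>\<^sub>0 rat"

definition X :: "nat \<Rightarrow> rat_mpoly" where
  "X i = Poly_Mapping.single (Poly_Mapping.single i 1) 1"

text \<open>The polynomial ring \<open>\<rat>[x\<^sub>0,\<dots>,x\<^sub>n\<^sub>-\<^sub>1]\<close>, as a subset of all polynomials.\<close>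

definition rat_mpolys :: "nat \<Rightarrow> rat_mpoly set" where
  "rat_mpolys n = {p. \<forall>m \<in> Poly_Mapping.keys p. Poly_Mapping.keys m \<subseteq> {..<n}}"

definition edge_label_poly :: "nat \<Rightarrow> (nat \<Rightarrow> nat) \<Rightarrow> rat_mpoly" where
  "edge_label_poly n f =
     (\<Prod>(i, j) \<in> {(i, j). i < j \<and> j < n}. (X (f j) - X j)\<^sup>2 - (X (f i) - X i)\<^sup>2)"

definition functional_digraph :: "nat \<Rightarrow> (nat \<Rightarrow> nat) \<Rightarrow> nat pair_pre_digraph" where
  "functional_digraph n f = \<lparr> pverts = {..<n}, parcs = {(i, f i) | i. i < n} \<rparr>"

text \<open>
  A simple graph is represented, as in the locale \<open>pair_graph\<close>, by a loop-free symmetric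
  digraph: the edge \<open>{i,j}\<close> is the pair of arcs \<open>(i,j)\<close> and \<open>(j,i)\<close>.
\<close>

definition underlying_graph :: "nat \<Rightarrow> (nat \<Rightarrow> nat) \<Rightarrow> nat pair_pre_digraph" where
  "underlying_graph n f =
     \<lparr> pverts = {..<n},
       parcs = {(i, j). i < n \<and> j < n \<and> i \<noteq> j \<and> (f i = j \<or> f j = i)} \<rparr>"

lemma pair_graph_underlying_graph: "pair_graph (underlying_graph n f)"
proof
  show "finite (parcs (underlying_graph n f))"
    by (rule finite_subset[of _ "{..<n} \<times> {..<n}"]) (auto simp: underlying_graph_def)
qed (auto simp: underlying_graph_def symmetric_def sym_def)

definition connected_map :: "nat \<Rightarrow> (nat \<Rightarrow> nat) \<Rightarrow> bool" where
  "connected_map n f \<longleftrightarrow> Digraph_Component.connected (with_proj (underlying_graph n f))"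

definition rooted_maps :: "nat \<Rightarrow> (nat \<Rightarrow> nat) set" where
  "rooted_maps n =
     {f \<in> self_maps n. f 0 = 0 \<and> (\<forall>i<n. f i = i \<longrightarrow> i = 0) \<and> connected_map n f}"

end

theory Submission
  imports Defs "HOL-Computational_Algebra.Polynomial"
begin

text \<open>
  Write \<open>L\<^sub>i = x\<^bsub>f(i)\<^esub> - x\<^sub>i\<close>, so that \<open>p\<^sub>f\<close> is the product of the linear forms \<open>L\<^sub>j \<plusminus> L\<^sub>i\<close>. If \<open>p\<^sub>f \<noteq> 0\<close>,
  then \<open>f\<close> has at most one fixed point and no 2-cycle. For distinct \<open>m\<close>, \<open>a\<close>, \<open>b\<close> the form
  \<open>2 x\<^sub>a - x\<^sub>m - x\<^sub>b\<close> divides \<open>p\<^sub>f\<close> iff \<open>m - a - b\<close> is a path of \<open>G\<^sub>f\<close>, which recovers every edge except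
  an isolated one; an isolated edge joins the fixed point to its only preimage, and is detected by
  the divisor \<open>x\<^sub>a - x\<^sub>b\<close>. So \<open>p\<^sub>f\<close> determines \<open>G\<^sub>f\<close> in all cases, and \<open>f\<close> has a fixed point iff
  \<open>G\<^sub>f\<close> does not have \<open>n\<close> edges. When \<open>G\<^sub>f\<close> is connected, every orbit ends in the fixed point \<open>c\<close>, and
  \<open>f\<close> is the orientation of \<open>G\<^sub>f\<close> towards \<open>c\<close>. Divisibility by a linear form is tested by
  substituting a generic point of its kernel with coordinates in \<open>\<rat>[t]\<close>, an integral domain.
\<close>

section \<open>Substitution into polynomials\<close>

definition monom_subst :: "(nat \<Rightarrow> rat poly) \<Rightarrow> (nat \<Rightarrow>\<^sub>0 nat) \<Rightarrow> rat poly" where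
  "monom_subst v m = (\<Prod>i\<in>Poly_Mapping.keys m. v i ^ Poly_Mapping.lookup m i)"

text \<open>The evaluation homomorphism into \<open>Q[t]\<close>. A single variable suffices for
  generic points, since the powers of t are linearly independent over the rationals.\<close>

definition poly_subst :: "(nat \<Rightarrow> rat poly) \<Rightarrow> rat_mpoly \<Rightarrow> rat poly" where
  "poly_subst v p =
     (\<Sum>m\<in>Poly_Mapping.keys p. smult (Poly_Mapping.lookup p m) (monom_subst v m))"

text \<open>Indices outside the support contribute a zeroth power, so two monomials can be evaluated
  over one common index set.\<close>

lemma monom_subst_superset:
  assumes "finite A" "Poly_Mapping.keys m \<subseteq> A"
  shows "monom_subst v m = (\<Prod>i\<in>A. v i ^ Poly_Mapping.lookup m i)"
  unfolding monom_subst_def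
  by (rule prod.mono_neutral_left) (use assms in \<open>auto simp: in_keys_iff\<close>)

lemma monom_subst_add: "monom_subst v (k + m) = monom_subst v k * monom_subst v m"
proof -
  let ?A = "Poly_Mapping.keys k \<union> Poly_Mapping.keys m"
  have "monom_subst v (k + m) = (\<Prod>i\<in>?A. v i ^ Poly_Mapping.lookup (k + m) i)"
    by (rule monom_subst_superset) (use Poly_Mapping.keys_add[of k m] in auto)
  moreover have "monom_subst v k = (\<Prod>i\<in>?A. v i ^ Poly_Mapping.lookup k i)"
    "monom_subst v m = (\<Prod>i\<in>?A. v i ^ Poly_Mapping.lookup m i)"
    by (rule monom_subst_superset; simp)+
  ultimately show ?thesis
    by (simp add: lookup_add power_add prod.distrib)
qed

lemma poly_subst_0: "poly_subst v 0 = 0"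
  by (simp add: poly_subst_def)

lemma poly_subst_single:
  "poly_subst v (Poly_Mapping.single m c) = smult c (monom_subst v m)"
  by (simp add: poly_subst_def)

lemma poly_subst_1: "poly_subst v 1 = 1"
  using poly_subst_single[of v 0 1] by (simp add: monom_subst_def)

lemma poly_subst_X: "poly_subst v (X i) = v i"
  by (simp add: X_def poly_subst_single monom_subst_def)

lemma poly_subst_add: "poly_subst v (p + q) = poly_subst v p + poly_subst v q"
  unfolding poly_subst_def
  by (rule setsum_keys_plus_distrib) (simp_all add: smult_add_left)

lemma poly_subst_diff: "poly_subst v (p - q) = poly_subst v p - poly_subst v q"
  using poly_subst_add[of v "p - q" q] by simp

lemma poly_subst_sum: "poly_subst v (\<Sum>i\<in>I. p i) = (\<Sum>i\<in>I. poly_subst v (p i))"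
  by (induction I rule: infinite_finite_induct) (simp_all add: poly_subst_0 poly_subst_add)

lemma rat_mpoly_as_sum:
  fixes p :: rat_mpoly
  shows "p = (\<Sum>m\<in>Poly_Mapping.keys p. Poly_Mapping.single m (Poly_Mapping.lookup p m))"
  by (rule poly_mapping_eqI)
    (auto simp: lookup_sum lookup_single when_def sum.delta in_keys_iff)

lemma poly_subst_mult: "poly_subst v (p * q) = poly_subst v p * poly_subst v q"
proof -
  let ?c = "Poly_Mapping.lookup"
  have "p * q = (\<Sum>k\<in>Poly_Mapping.keys p. \<Sum>m\<in>Poly_Mapping.keys q.
      Poly_Mapping.single (k + m) (?c p k * ?c q m))"
    by (subst rat_mpoly_as_sum[of p], subst rat_mpoly_as_sum[of q])
      (simp add: sum_product mult_single)
  then have "poly_subst v (p * q) = (\<Sum>k\<in>Poly_Mapping.keys p. \<Sum>m\<in>Poly_Mapping.keys q.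
      smult (?c p k) (monom_subst v k) * smult (?c q m) (monom_subst v m))"
    by (simp add: poly_subst_sum poly_subst_single monom_subst_add mult.commute)
  also have "\<dots> = poly_subst v p * poly_subst v q"
    by (simp only: poly_subst_def sum_product)
  finally show ?thesis .
qed

lemma poly_subst_power2: "poly_subst v (p\<^sup>2) = (poly_subst v p)\<^sup>2"
  by (simp add: power2_eq_square poly_subst_mult)

lemma poly_subst_prod: "poly_subst v (\<Prod>i\<in>I. p i) = (\<Prod>i\<in>I. poly_subst v (p i))"
  by (induction I rule: infinite_finite_induct) (simp_all add: poly_subst_1 poly_subst_mult)

section \<open>Zeros of the edge-labeling polynomial\<close>

lemma finite_less_pairs: "finite {(i, j). i < j \<and> j < (n::nat)}"
  by (rule finite_subset[of _ "{..<n} \<times> {..<n}"]) auto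

text \<open>A product in an integral domain vanishes iff a factor does, and two squares agree iff
  their bases agree up to sign. Moving negative terms across leaves equalities between sums of two
  coordinates, which coefficient comparison can settle.\<close>

lemma poly_subst_edge_label_poly_eq_0_iff:
  "poly_subst v (edge_label_poly n f) = 0 \<longleftrightarrow>
     (\<exists>i<n. \<exists>j<n. i \<noteq> j \<and> (v (f j) + v i = v (f i) + v j \<or> v (f j) + v (f i) = v i + v j))"
proof -
  have lin: "x - y = z - w \<longleftrightarrow> x + w = z + y" "x - y = - (z - w) \<longleftrightarrow> x + z = w + y"
    for x y z w :: "rat poly"
    by (auto simp: algebra_simps)
  have fac: "(v (f j) - v j)\<^sup>2 - (v (f i) - v i)\<^sup>2 = 0 \<longleftrightarrow>
      v (f j) + v i = v (f i) + v j \<or> v (f j) + v (f i) = v i + v j" for i j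
    unfolding right_minus_eq power2_eq_iff lin ..
  let ?P = "\<lambda>i j. v (f j) + v i = v (f i) + v j \<or> v (f j) + v (f i) = v i + v j"
  have "poly_subst v (edge_label_poly n f) =
      (\<Prod>(i, j)\<in>{(i, j). i < j \<and> j < n}. (v (f j) - v j)\<^sup>2 - (v (f i) - v i)\<^sup>2)"
    unfolding edge_label_poly_def poly_subst_prod case_prod_unfold
    by (simp only: poly_subst_diff poly_subst_power2 poly_subst_X)
  then have "poly_subst v (edge_label_poly n f) = 0 \<longleftrightarrow> (\<exists>i j. i < j \<and> j < n \<and> ?P i j)"
    by (simp only: prod_zero_iff[OF finite_less_pairs[unfolded case_prod_unfold]] fac
        case_prod_unfold Bex_def mem_Collect_eq split_paired_Ex fst_conv snd_conv conj_assoc)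
  \<comment> \<open>The condition is symmetric in \<open>i\<close> and \<open>j\<close>, so the
    ordering relaxes to distinctness.\<close>
  also have "\<dots> \<longleftrightarrow> (\<exists>i<n. \<exists>j<n. i \<noteq> j \<and> ?P i j)"
  proof
    assume "\<exists>i<n. \<exists>j<n. i \<noteq> j \<and> ?P i j"
    then obtain i j where ij: "i < n" "j < n" "i \<noteq> j" and P: "?P i j"
      by blast
    have "?P j i"
      using P by (metis add.commute)
    with ij P show "\<exists>i j. i < j \<and> j < n \<and> ?P i j"
      by (cases i j rule: linorder_cases) blast+
  next
    assume "\<exists>i j. i < j \<and> j < n \<and> ?P i j"
    then obtain i j where ij: "i < j" "j < n" and P: "?P i j"
      by blast
    have "i < n" "i \<noteq> j"
      using ij by auto
    with ij(2) P show "\<exists>i<n. \<exists>j<n. i \<noteq> j \<and> ?P i j"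
      by blast
  qed
  finally show ?thesis .
qed

lemma poly_subst_edge_label_poly_eq_0I:
  assumes "i < n" "j < n" "i \<noteq> j"
    and "v (f j) + v i = v (f i) + v j \<or> v (f j) + v (f i) = v i + v j"
  shows "poly_subst v (edge_label_poly n f) = 0"
  unfolding poly_subst_edge_label_poly_eq_0_iff using assms by blast

text \<open>The form in which nonvanishing of the polynomial is used; for rooted maps it is derived
  from connectedness instead.\<close>

definition nondegenerate :: "nat \<Rightarrow> (nat \<Rightarrow> nat) \<Rightarrow> bool" where
  "nondegenerate n f \<longleftrightarrow>
     (\<forall>i<n. \<forall>j<n. i \<noteq> j \<longrightarrow> \<not> (f i = i \<and> f j = j) \<and> \<not> (f i = j \<and> f j = i))"

text \<open>Two fixed points give \<open>L_i = L_j = 0\<close> and a 2-cycle gives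
  \<open>L_j = - L_i\<close>; either way a factor is zero.\<close>

lemma nondegenerate_if_edge_label_poly_neq_0:
  assumes "edge_label_poly n f \<noteq> 0"
  shows "nondegenerate n f"
proof -
  have False if "i < n" "j < n" "i \<noteq> j" and deg: "f i = i \<and> f j = j \<or> f i = j \<and> f j = i" for i j
  proof -
    obtain k l where kl: "k < l" "l < n" "{k, l} = {i, j}"
      using \<open>i < n\<close> \<open>j < n\<close> \<open>i \<noteq> j\<close> by (metis insert_commute linorder_neqE_nat)
    then have "f k = k \<and> f l = l \<or> f k = l \<and> f l = k"
      using deg by (auto simp: doubleton_eq_iff)
    then have "(X (f l) - X l)\<^sup>2 - (X (f k) - X k)\<^sup>2 = 0"
      by (auto simp: power2_commute)
    with kl have "\<exists>x\<in>{(i, j). i < j \<and> j < n}.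
        (case x of (i, j) \<Rightarrow> (X (f j) - X j)\<^sup>2 - (X (f i) - X i)\<^sup>2) = 0"
      by (intro bexI[of _ "(k, l)"]) auto
    then have "edge_label_poly n f = 0"
      unfolding edge_label_poly_def by (intro prod_zero finite_less_pairs)
    then show False
      using assms by simp
  qed
  then show ?thesis
    unfolding nondegenerate_def by blast
qed

section \<open>Adjacency read off from zeros at generic points\<close>

definition adjacent :: "(nat \<Rightarrow> nat) \<Rightarrow> nat \<Rightarrow> nat \<Rightarrow> bool" where
  "adjacent f a b \<longleftrightarrow> a \<noteq> b \<and> (f a = b \<or> f b = a)"

text \<open>Generic points of the hyperplanes \<open>x\<^sub>a = x\<^sub>b\<close> and \<open>2 x\<^sub>a = x\<^sub>m + x\<^sub>b\<close>.\<close>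

definition merge_point :: "nat \<Rightarrow> nat \<Rightarrow> nat \<Rightarrow> rat poly" where
  "merge_point a b k = monom 1 (if k = b then a else k)"

definition midpoint_point :: "nat \<Rightarrow> nat \<Rightarrow> nat \<Rightarrow> nat \<Rightarrow> rat poly" where
  "midpoint_point a m b k = (if k = a then monom 1 m + monom 1 b else monom 2 k)"

lemma monom_add_monom_eq_iff:
  "monom (1::rat) p + monom 1 q = monom 1 r + monom 1 s \<longleftrightarrow>
     p = r \<and> q = s \<or> p = s \<and> q = r"
proof
  assume eq: "monom (1::rat) p + monom 1 q = monom 1 r + monom 1 s"
  have "coeff (monom (1::rat) p + monom 1 q) k = coeff (monom 1 r + monom 1 s) k" for k
    by (simp only: eq)
  from this[of p] this[of q] show "p = r \<and> q = s \<or> p = s \<and> q = r"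
    by (auto split: if_splits)
qed (auto simp: add.commute)

text \<open>The coordinates other than that of \<open>a\<close> are independent, and that of
  \<open>a\<close> is half the sum of those of \<open>m\<close> and \<open>b\<close> (the factor 2
  avoids fractions). So the only nontrivial coincidence is the defining relation itself.\<close>

lemma midpoint_point_add_eqD:
  assumes ne: "m \<noteq> a" "b \<noteq> a" "m \<noteq> b"
    and eq: "midpoint_point a m b p + midpoint_point a m b q =
      midpoint_point a m b r + midpoint_point a m b s"
  shows "p = r \<and> q = s \<or> p = s \<and> q = r \<or>
    p = a \<and> q = a \<and> {r, s} = {m, b} \<or> r = a \<and> s = a \<and> {p, q} = {m, b}"
proof -
  let ?c = "\<lambda>k x. if x = a then (if k = m \<or> k = b then 1 else 0) else if k = x then 2 else (0::rat)"
  have c: "coeff (midpoint_point a m b x) k = ?c k x" for k x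
    using ne by (auto simp: midpoint_point_def)
  have *: "?c k p + ?c k q = ?c k r + ?c k s" for k
    unfolding c[symmetric] coeff_add[symmetric] eq ..
  \<comment> \<open>The cases count the occurrences of \<open>a\<close>. On each side the
    coefficient at \<open>m\<close> has the parity of that count, so the two counts agree mod
    2.\<close>
  consider "p \<noteq> a" "q \<noteq> a" "r \<noteq> a" "s \<noteq> a" | "p = a" "q = a" | "r = a" "s = a"
    | "p \<noteq> a" "q \<noteq> a" "(r = a) \<noteq> (s = a)"
    | "p = a" "q \<noteq> a" "r \<noteq> a \<or> s \<noteq> a" | "p \<noteq> a" "q = a" "r \<noteq> a \<or> s \<noteq> a"
    by blast
  then show ?thesis
  proof cases
    case 1
    then show ?thesis
      using *[of p] *[of q] ne by (auto simp: doubleton_eq_iff split: if_splits)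
  next
    case 2
    then show ?thesis
      using *[of m] *[of b] ne by (auto simp: doubleton_eq_iff split: if_splits)
  next
    case 3
    then show ?thesis
      using *[of m] *[of b] ne by (auto simp: doubleton_eq_iff split: if_splits)
  next
    case 4
    then show ?thesis
      using *[of m] ne by (auto simp: doubleton_eq_iff split: if_splits)
  next
    case 5
    then show ?thesis
      using *[of m] *[of q] ne by (auto simp: doubleton_eq_iff split: if_splits)
  next
    case 6
    then show ?thesis
      using *[of m] *[of p] ne by (auto simp: doubleton_eq_iff split: if_splits)
  qed
qed

text \<open>Trivial coincidences of coordinates would mean \<open>i = j\<close>, two fixed points or
  a 2-cycle. The others put \<open>a\<close> in the middle of a path.\<close>

lemma midpoint_zero_iff:
  assumes nd: "nondegenerate n f" and lt: "a < n" "m < n" "b < n"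
    and ne: "m \<noteq> a" "b \<noteq> a" "m \<noteq> b"
  shows "poly_subst (midpoint_point a m b) (edge_label_poly n f) = 0 \<longleftrightarrow>
    adjacent f a m \<and> adjacent f a b"
proof
  assume "poly_subst (midpoint_point a m b) (edge_label_poly n f) = 0"
  then obtain i j where ij: "i < n" "j < n" "i \<noteq> j"
    and "midpoint_point a m b (f j) + midpoint_point a m b i =
        midpoint_point a m b (f i) + midpoint_point a m b j \<or>
      midpoint_point a m b (f j) + midpoint_point a m b (f i) =
        midpoint_point a m b i + midpoint_point a m b j"
    unfolding poly_subst_edge_label_poly_eq_0_iff by blast
  then have "f j = a \<and> i = a \<and> {f i, j} = {m, b} \<or> f i = a \<and> j = a \<and> {f j, i} = {m, b} \<or>
      f j = a \<and> f i = a \<and> {i, j} = {m, b} \<or> f j = j \<and> f i = i \<or> f i = j \<and> f j = i"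
    using midpoint_point_add_eqD[OF ne, of "f j" i "f i" j]
      midpoint_point_add_eqD[OF ne, of "f j" "f i" i j] ij(3) by (smt (verit))
  moreover have "\<not> (f i = i \<and> f j = j)" "\<not> (f i = j \<and> f j = i)"
    using nd ij unfolding nondegenerate_def by blast+
  ultimately consider "f j = a" "i = a" "{f i, j} = {m, b}" | "f i = a" "j = a" "{f j, i} = {m, b}"
    | "f j = a" "f i = a" "{i, j} = {m, b}"
    by blast
  then show "adjacent f a m \<and> adjacent f a b"
    using ne by cases (auto simp: adjacent_def doubleton_eq_iff)
next
  let ?v = "midpoint_point a m b"
  assume "adjacent f a m \<and> adjacent f a b"
  \<comment> \<open>The two edges cannot both leave \<open>a\<close>, as \<open>m\<close> and
    \<open>b\<close> differ. A directed path through \<open>a\<close> is a zero of a difference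
    \<open>L_j - L_i\<close>, two arcs into \<open>a\<close> are a zero of a sum.\<close>
  then consider "f m = a" "f a = b" | "f b = a" "f a = m" | "f m = a" "f b = a"
    using ne by (auto simp: adjacent_def)
  moreover have mid: "?v a + ?v a = ?v m + ?v b"
  proof (rule poly_eqI)
    show "coeff (?v a + ?v a) k = coeff (?v m + ?v b) k" for k
      using ne unfolding coeff_add by (simp add: midpoint_point_def)
  qed
  ultimately show "poly_subst ?v (edge_label_poly n f) = 0"
  proof cases
    case 1
    have eq: "?v (f m) + ?v a = ?v (f a) + ?v m"
      unfolding 1 mid by (simp add: add.commute)
    show ?thesis
      by (rule poly_subst_edge_label_poly_eq_0I[of a n m ?v f, OF lt(1,2) ne(1)[symmetric] disjI1[OF eq]])
  next
    case 2
    have eq: "?v (f b) + ?v a = ?v (f a) + ?v b"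
      unfolding 2 mid by (simp add: add.commute)
    show ?thesis
      by (rule poly_subst_edge_label_poly_eq_0I[of a n b ?v f, OF lt(1,3) ne(2)[symmetric] disjI1[OF eq]])
  next
    case 3
    have eq: "?v (f b) + ?v (f m) = ?v m + ?v b"
      unfolding 3 mid by (simp add: add.commute)
    show ?thesis
      by (rule poly_subst_edge_label_poly_eq_0I[of m n b ?v f, OF lt(2,3) ne(3) disjI2[OF eq]])
  qed
qed

lemma merge_zeroD:
  assumes nd: "nondegenerate n f" and f: "f \<in> {..<n} \<rightarrow> {..<n}"
    and "a \<noteq> b" "poly_subst (merge_point a b) (edge_label_poly n f) = 0"
  shows "adjacent f a b \<or> (\<exists>m<n. adjacent f m a \<and> adjacent f m b)"
proof -
  define \<pi> where "\<pi> k = (if k = b then a else k)" for k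
  have v: "merge_point a b k = monom 1 (\<pi> k)" for k
    by (simp add: merge_point_def \<pi>_def)
  obtain i j where ij: "i < n" "j < n" "i \<noteq> j"
    and eq: "(\<pi> (f j) = \<pi> (f i) \<and> \<pi> i = \<pi> j \<or> \<pi> (f j) = \<pi> j \<and> \<pi> i = \<pi> (f i)) \<or>
      \<pi> (f j) = \<pi> i \<and> \<pi> (f i) = \<pi> j \<or> \<pi> (f j) = \<pi> j \<and> \<pi> (f i) = \<pi> i"
    using assms(4) unfolding poly_subst_edge_label_poly_eq_0_iff v monom_add_monom_eq_iff
    by (elim exE conjE) (rule that)
  have fij: "\<not> (f i = i \<and> f j = j)" "\<not> (f i = j \<and> f j = i)"
    using nd ij unfolding nondegenerate_def by blast+
  have \<pi>: "\<pi> x = \<pi> y \<longleftrightarrow> x = y \<or> x = a \<and> y = b \<or> x = b \<and> y = a" for x y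
    by (auto simp: \<pi>_def)
  have fn: "f i < n"
    using f ij by auto
  \<comment> \<open>In turn: a common image of \<open>a\<close> and \<open>b\<close>, an arc
    collapsed by identifying them, and a directed path of length two between them.\<close>
  consider "\<pi> (f j) = \<pi> (f i)" "\<pi> i = \<pi> j" | "\<pi> (f j) = \<pi> j" "\<pi> i = \<pi> (f i)"
    | "\<pi> (f j) = \<pi> i" "\<pi> (f i) = \<pi> j"
    using eq by metis
  then show ?thesis
  proof cases
    case 1
    then have "f j = f i" "i = a \<and> j = b \<or> i = b \<and> j = a"
      using ij(3) fij unfolding \<pi> by (smt (verit))+
    then show ?thesis
      using fn ij(3) by (auto simp: adjacent_def)
  next
    case 2
    then show ?thesis
      using ij(3) fij \<open>a \<noteq> b\<close> unfolding \<pi> adjacent_def by (smt (verit))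
  next
    case 3
    then consider "f j = i" "f i = a \<and> j = b \<or> f i = b \<and> j = a"
      | "f i = j" "f j = a \<and> i = b \<or> f j = b \<and> i = a"
      using ij(3) fij unfolding \<pi> by (smt (verit))
    then show ?thesis
      by cases (use ij \<open>a \<noteq> b\<close> in \<open>auto simp: adjacent_def\<close>)
  qed
qed

text \<open>The form of the fixed end is zero and that of the other end is \<open>x_a - x_b\<close>
  up to sign.\<close>

lemma merge_zero_of_fixed_point:
  assumes "a < n" "b < n" "adjacent f a b" "f a = a \<or> f b = b"
  shows "poly_subst (merge_point a b) (edge_label_poly n f) = 0"
proof -
  have "a \<noteq> b" "f a = a \<and> f b = a \<or> f a = b \<and> f b = b"
    using assms by (auto simp: adjacent_def)
  then show ?thesis
    by (intro poly_subst_edge_label_poly_eq_0I[of a n b "merge_point a b" f, OF assms(1,2)]) (auto simp: merge_point_def)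
qed

text \<open>
  An edge belonging to a path of length two is seen by the midpoint zeros. Without 2-cycles, the
  only other kind of edge is a component on two vertices one of which is fixed.
\<close>

lemma adjacent_iff_zeros:
  assumes nd: "nondegenerate n f" and f: "f \<in> {..<n} \<rightarrow> {..<n}"
    and lt: "a < n" "b < n" and "a \<noteq> b"
  defines "mid \<equiv> \<lambda>a m b. m < n \<and> m \<noteq> a \<and> b \<noteq> a \<and> m \<noteq> b \<and>
    poly_subst (midpoint_point a m b) (edge_label_poly n f) = 0"
  shows "adjacent f a b \<longleftrightarrow>
    (\<exists>m. mid a m b \<or> mid b m a) \<or>
    poly_subst (merge_point a b) (edge_label_poly n f) = 0 \<and>
      (\<forall>m<n. m \<noteq> a \<and> m \<noteq> b \<longrightarrow>
        poly_subst (midpoint_point m a b) (edge_label_poly n f) \<noteq> 0)"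
proof -
  have mid: "mid x m y \<longleftrightarrow> m < n \<and> m \<noteq> y \<and> adjacent f x m \<and> adjacent f x y"
    if "x < n" "y < n" for x m y
  proof (cases "m < n \<and> m \<noteq> x \<and> y \<noteq> x \<and> m \<noteq> y")
    case True
    then show ?thesis
      using midpoint_zero_iff[OF nd that(1) _ that(2), of m] by (simp add: mid_def)
  next
    case False
    then show ?thesis
      unfolding mid_def adjacent_def by (smt (verit))
  qed
  have sym: "adjacent f x y \<longleftrightarrow> adjacent f y x" for x y
    by (auto simp: adjacent_def)
  \<comment> \<open>This is the negation of the second outcome of
    \<open>merge_zeroD\<close>.\<close>
  have cent: "(\<forall>m<n. m \<noteq> a \<and> m \<noteq> b \<longrightarrow>
        poly_subst (midpoint_point m a b) (edge_label_poly n f) \<noteq> 0) \<longleftrightarrow>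
      \<not> (\<exists>m<n. adjacent f m a \<and> adjacent f m b)"
  proof -
    have "poly_subst (midpoint_point m a b) (edge_label_poly n f) = 0 \<longleftrightarrow>
        adjacent f m a \<and> adjacent f m b" if "m < n" "m \<noteq> a" "m \<noteq> b" for m
      using midpoint_zero_iff[OF nd that(1) lt] that \<open>a \<noteq> b\<close> by simp
    moreover have "m \<noteq> a \<and> m \<noteq> b" if "adjacent f m a \<and> adjacent f m b" for m
      using that by (simp add: adjacent_def)
    ultimately show ?thesis
      by blast
  qed
  show ?thesis
  proof
    assume adj: "adjacent f a b"
    show "(\<exists>m. mid a m b \<or> mid b m a) \<or>
      poly_subst (merge_point a b) (edge_label_poly n f) = 0 \<and>
        (\<forall>m<n. m \<noteq> a \<and> m \<noteq> b \<longrightarrow>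
          poly_subst (midpoint_point m a b) (edge_label_poly n f) \<noteq> 0)"
    proof (cases "\<exists>m. mid a m b \<or> mid b m a")
      case False
      \<comment> \<open>Without midpoint zeros, \<open>a\<close> and \<open>b\<close> have only each
        other as neighbours, so \<open>f\<close> maps each of them into the pair.\<close>
      then have no: "m = b" if "m < n" "adjacent f a m" for m
        using that adj mid[OF lt, of m] False by metis
      have no': "m = a" if "m < n" "adjacent f b m" for m
        using that adj mid[OF lt(2,1), of m] False sym by metis
      have "f a < n" "f b < n"
        using f lt by auto
      then have "f a = b \<or> f a = a" "f b = a \<or> f b = b"
        using no[of "f a"] no'[of "f b"] unfolding adjacent_def by metis+
      moreover have "\<not> (f a = b \<and> f b = a)"
        using nd lt \<open>a \<noteq> b\<close> unfolding nondegenerate_def by blast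
      ultimately have "poly_subst (merge_point a b) (edge_label_poly n f) = 0"
        using merge_zero_of_fixed_point[OF lt adj] by blast
      moreover have "\<not> (\<exists>m<n. adjacent f m a \<and> adjacent f m b)"
        using no sym[of _ a] by (auto simp: adjacent_def)
      ultimately show ?thesis
        unfolding cent by blast
    qed simp
  next
    assume "(\<exists>m. mid a m b \<or> mid b m a) \<or>
      poly_subst (merge_point a b) (edge_label_poly n f) = 0 \<and>
        (\<forall>m<n. m \<noteq> a \<and> m \<noteq> b \<longrightarrow>
          poly_subst (midpoint_point m a b) (edge_label_poly n f) \<noteq> 0)"
    then show "adjacent f a b"
      unfolding cent mid[OF lt] mid[OF lt(2,1)]
      using sym[of b a] sym[of b] merge_zeroD[OF nd f \<open>a \<noteq> b\<close>] by blast
  qed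
qed

section \<open>Recovery of the graph\<close>

lemma underlying_graph_eq_iff:
  "underlying_graph n g = underlying_graph n f \<longleftrightarrow>
     (\<forall>a<n. \<forall>b<n. adjacent g a b = adjacent f a b)"
proof -
  have "parcs (underlying_graph n h) = {(a, b). a < n \<and> b < n \<and> adjacent h a b}" for h
    by (simp add: underlying_graph_def adjacent_def)
  then have "underlying_graph n h =
      \<lparr>pverts = {..<n}, parcs = {(a, b). a < n \<and> b < n \<and> adjacent h a b}\<rparr>" for h
    by (simp add: underlying_graph_def)
  then show ?thesis
    by (simp add: set_eq_iff) blast
qed

lemma underlying_graph_eq_of_edge_label_poly_eq:
  assumes nd: "nondegenerate n f" "nondegenerate n g"
    and f: "f \<in> {..<n} \<rightarrow> {..<n}" and g: "g \<in> {..<n} \<rightarrow> {..<n}"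
    and eq: "edge_label_poly n g = edge_label_poly n f"
  shows "underlying_graph n g = underlying_graph n f"
  unfolding underlying_graph_eq_iff
proof (intro allI impI)
  fix a b assume "a < n" "b < n"
  then show "adjacent g a b = adjacent f a b"
    using adjacent_iff_zeros[OF nd(1) f, of a b] adjacent_iff_zeros[OF nd(2) g, of a b]
    unfolding eq by (cases "a = b") (auto simp: adjacent_def)
qed

section \<open>Fixed points and connectedness\<close>

text \<open>Each non-fixed \<open>i\<close> yields the edge \<open>{i, f i}\<close>, and two of them
  yield the same edge only in a 2-cycle.\<close>

lemma card_edges:
  assumes nd: "nondegenerate n f" and f: "f \<in> {..<n} \<rightarrow> {..<n}"
  shows "card {{a, b} | a b. a < n \<and> b < n \<and> adjacent f a b} = card {i. i < n \<and> f i \<noteq> i}"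
proof -
  have "{{a, b} | a b. a < n \<and> b < n \<and> adjacent f a b} = (\<lambda>i. {i, f i}) ` {i. i < n \<and> f i \<noteq> i}"
    (is "?E = ?F")
  proof
    show "?E \<subseteq> ?F"
      by (auto simp: adjacent_def image_iff insert_commute)
    show "?F \<subseteq> ?E"
      using f by (force simp: adjacent_def)
  qed
  moreover have "inj_on (\<lambda>i. {i, f i}) {i. i < n \<and> f i \<noteq> i}"
    using nd by (auto simp: inj_on_def doubleton_eq_iff nondegenerate_def)
  ultimately show ?thesis
    by (simp add: card_image)
qed

lemma fixed_point_iff_card_edges:
  assumes nd: "nondegenerate n f" and f: "f \<in> {..<n} \<rightarrow> {..<n}"
  shows "(\<exists>i<n. f i = i) \<longleftrightarrow> card {{a, b} | a b. a < n \<and> b < n \<and> adjacent f a b} \<noteq> n"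
proof
  assume "\<exists>i<n. f i = i"
  then have "{i. i < n \<and> f i \<noteq> i} \<subset> {..<n}"
    by auto
  then have "card {i. i < n \<and> f i \<noteq> i} < card {..<n}"
    by (intro psubset_card_mono) auto
  then show "card {{a, b} | a b. a < n \<and> b < n \<and> adjacent f a b} \<noteq> n"
    unfolding card_edges[OF assms] by simp
next
  assume "card {{a, b} | a b. a < n \<and> b < n \<and> adjacent f a b} \<noteq> n"
  then have "{i. i < n \<and> f i \<noteq> i} \<noteq> {..<n}"
    unfolding card_edges[OF assms] by force
  then show "\<exists>i<n. f i = i"
    by auto
qed

lemma fixed_point_iff_of_underlying_graph_eq:
  assumes "nondegenerate n f" "nondegenerate n g"
    and "f \<in> {..<n} \<rightarrow> {..<n}" "g \<in> {..<n} \<rightarrow> {..<n}"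
    and "underlying_graph n g = underlying_graph n f"
  shows "(\<exists>i<n. f i = i) \<longleftrightarrow> (\<exists>i<n. g i = i)"
proof -
  have "{{a, b} | a b. a < n \<and> b < n \<and> adjacent g a b} =
      {{a, b} | a b. a < n \<and> b < n \<and> adjacent f a b}"
    using assms(5) unfolding underlying_graph_eq_iff by blast
  then show ?thesis
    unfolding fixed_point_iff_card_edges[OF assms(1,3)] fixed_point_iff_card_edges[OF assms(2,4)]
    by simp
qed

text \<open>Induction along a walk from \<open>c\<close>: the next vertex is a preimage of the
  current one, which lengthens the orbit by one step, or its image, whose orbit still meets
  \<open>c\<close> because \<open>c\<close> is fixed.\<close>

lemma connected_map_reaches_fixed_point:
  assumes "connected_map n f" "c < n" "f c = c" "v < n"
  shows "\<exists>k. (f ^^ k) v = c"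
proof -
  have "c \<rightarrow>\<^sup>*\<^bsub>with_proj (mk_symmetric (with_proj (underlying_graph n f)))\<^esub> v"
    using assms
    by (auto simp: connected_map_def Digraph_Component.connected_def strongly_connected_def
        underlying_graph_def)
  then show ?thesis
    unfolding reachable_def
  proof (induction rule: rtrancl_on_induct)
    case base
    have "(f ^^ 0) c = c"
      by simp
    then show ?case ..
  next
    case (step x y)
    then obtain k where k: "(f ^^ k) x = c"
      by blast
    have "f x = y \<or> f y = x"
      using step(2) by (auto simp: parcs_mk_symmetric underlying_graph_def)
    then show ?case
    proof
      assume "f x = y"
      then have "(f ^^ k) y = f ((f ^^ k) x)"
        by (simp add: funpow_swap1)
      with k assms(3) show ?thesis
        by auto
    next
      assume "f y = x"
      then have "(f ^^ Suc k) y = c"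
        using k by (simp add: funpow_swap1)
      then show ?thesis ..
    qed
  qed
qed

lemma funpow_fixed_point: "f c = c \<Longrightarrow> (f ^^ k) c = c"
  by (induction k) auto

text \<open>The orbit of a 2-cycle stays in the cycle but must reach 0 by connectedness, which is
  impossible because 0 is fixed.\<close>

lemma nondegenerate_if_rooted:
  assumes "f \<in> rooted_maps n"
  shows "nondegenerate n f"
proof -
  have f: "f 0 = 0" "\<And>i. i < n \<Longrightarrow> f i = i \<Longrightarrow> i = 0" "connected_map n f"
    using assms by (auto simp: rooted_maps_def)
  have "\<not> (f i = j \<and> f j = i)" if "i < n" "j < n" "i \<noteq> j" for i j
  proof
    assume ij: "f i = j \<and> f j = i"
    have orbit: "(f ^^ k) i \<in> {i, j}" for k
      using ij by (induction k) auto
    have "\<exists>k. (f ^^ k) i = 0"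
      using connected_map_reaches_fixed_point[of n f 0 i] f that by simp
    with orbit have "i = 0 \<or> j = 0"
      by (metis insertE singletonD)
    then show False
      using ij f(1) \<open>i \<noteq> j\<close> by auto
  qed
  then show ?thesis
    using f(2) unfolding nondegenerate_def by metis
qed

text \<open>
  If \<open>g v = w\<close> but \<open>f v \<noteq> w\<close>, the common edge forces \<open>f w = v\<close>. As \<open>w\<close> is closer to \<open>c\<close> under
  \<open>g\<close>, inductively \<open>g w = f w = v\<close>, so \<open>g\<close> has a 2-cycle.
\<close>

lemma eq_on_orbit_to_fixed_point:
  assumes nd: "nondegenerate n g" and g: "g \<in> {..<n} \<rightarrow> {..<n}"
    and eq: "underlying_graph n g = underlying_graph n f" and c: "f c = c" "g c = c"
  shows "v < n \<Longrightarrow> (g ^^ k) v = c \<Longrightarrow> g v = f v"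
proof (induction k arbitrary: v)
  case 0
  then show ?case
    using c by simp
next
  case (Suc k)
  have w: "g v < n" "(g ^^ k) (g v) = c"
    using Suc.prems g by (auto simp: funpow_swap1)
  then have IH: "g (g v) = f (g v)"
    by (rule Suc.IH)
  show ?case
  proof (rule ccontr)
    assume neq: "g v \<noteq> f v"
    \<comment> \<open>Otherwise the orbit is constant, so \<open>v = c\<close>, where both maps
      agree.\<close>
    have "g v \<noteq> v"
      using w neq c funpow_fixed_point[of g v k] by auto
    then have "adjacent f v (g v)"
      using eq w Suc.prems(1) unfolding underlying_graph_eq_iff by (auto simp: adjacent_def)
    then have "g (g v) = v"
      using neq IH by (auto simp: adjacent_def)
    then show False
      using nd w(1) Suc.prems(1) \<open>g v \<noteq> v\<close> unfolding nondegenerate_def by metis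
  qed
qed

lemma eq_of_underlying_graph_eq:
  assumes "nondegenerate n g" and fg: "f \<in> self_maps n" "g \<in> self_maps n"
    and eq: "underlying_graph n g = underlying_graph n f" and "connected_map n f"
    and c: "c < n" "f c = c" "g c = c"
  shows "g = f"
proof (rule PiE_ext[OF fg(2,1)])
  fix v assume "v \<in> {..<n}"
  then have "v < n"
    by simp
  \<comment> \<open>Connectedness depends on the graph alone, so it passes to \<open>g\<close>,
    whose orbits the induction follows.\<close>
  have "connected_map n g"
    using assms(5) eq by (simp add: connected_map_def)
  from connected_map_reaches_fixed_point[OF this \<open>c < n\<close> \<open>g c = c\<close> \<open>v < n\<close>]
  obtain k where k: "(g ^^ k) v = c" ..
  have "g \<in> {..<n} \<rightarrow> {..<n}"
    using fg by (simp add: PiE_def)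
  from eq_on_orbit_to_fixed_point[OF assms(1) this eq c(2,3) \<open>v < n\<close> k]
  show "g v = f v" .
qed

section \<open>The polynomial subring\<close>

lemma X_in_rat_mpolys: "i < n \<Longrightarrow> X i \<in> rat_mpolys n"
  by (simp add: rat_mpolys_def X_def)

lemma diff_in_rat_mpolys: "p \<in> rat_mpolys n \<Longrightarrow> q \<in> rat_mpolys n \<Longrightarrow> p - q \<in> rat_mpolys n"
  using keys_diff[of p q] unfolding rat_mpolys_def by blast

lemma mult_in_rat_mpolys: "p \<in> rat_mpolys n \<Longrightarrow> q \<in> rat_mpolys n \<Longrightarrow> p * q \<in> rat_mpolys n"
proof -
  assume p: "p \<in> rat_mpolys n" and q: "q \<in> rat_mpolys n"
  have "Poly_Mapping.keys m \<subseteq> {..<n}" if m: "m \<in> Poly_Mapping.keys (p * q)" for m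
  proof -
    obtain a b where "m = a + b" "a \<in> Poly_Mapping.keys p" "b \<in> Poly_Mapping.keys q"
      using m keys_mult[of p q] by blast
    then show ?thesis
      using p q Poly_Mapping.keys_add[of a b] unfolding rat_mpolys_def by blast
  qed
  then show ?thesis
    by (simp add: rat_mpolys_def)
qed

lemma prod_in_rat_mpolys: "(\<And>i. i \<in> I \<Longrightarrow> p i \<in> rat_mpolys n) \<Longrightarrow> prod p I \<in> rat_mpolys n"
  by (induction I rule: infinite_finite_induct) (auto simp: mult_in_rat_mpolys, auto simp: rat_mpolys_def)

lemma edge_label_poly_in_rat_mpolys:
  assumes "f \<in> {..<n} \<rightarrow> {..<n}"
  shows "edge_label_poly n f \<in> rat_mpolys n"
  unfolding edge_label_poly_def
  using assms
  by (intro prod_in_rat_mpolys)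
    (auto simp: power2_eq_square intro!: diff_in_rat_mpolys mult_in_rat_mpolys X_in_rat_mpolys)

theorem lemmaA5:
  fixes n :: nat
  assumes "n \<ge> 1"
  shows
    "(\<forall>f \<in> self_maps n. edge_label_poly n f \<noteq> 0 \<longrightarrow>
        ((\<exists>i<n. f i = i) \<longrightarrow> (\<exists>!i. i < n \<and> f i = i)) \<and>
        (\<forall>g \<in> self_maps n. edge_label_poly n g = edge_label_poly n f \<longrightarrow>
           ((\<exists>i<n. f i = i) \<longleftrightarrow> (\<exists>i<n. g i = i))))
   \<and> (\<forall>f \<in> self_maps n. edge_label_poly n f \<noteq> 0 \<and> (\<exists>i<n. f i = i) \<longrightarrow>
        (\<forall>g \<in> self_maps n. edge_label_poly n g = edge_label_poly n f \<longrightarrow>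
           underlying_graph n g = underlying_graph n f))
   \<and> (\<forall>f \<in> self_maps n. \<forall>c<n.
        edge_label_poly n f \<noteq> 0 \<and> f c = c \<and> connected_map n f \<longrightarrow>
        (\<forall>g \<in> self_maps n. edge_label_poly n g = edge_label_poly n f \<and> g c = c \<longrightarrow>
           g = f \<and> functional_digraph n g = functional_digraph n f))
   \<and> (edge_label_poly n \<in> rooted_maps n \<rightarrow> rat_mpolys n \<and>
      inj_on (edge_label_poly n) (rooted_maps n))"
proof (intro conjI ballI allI impI)
  fix f assume f: "f \<in> self_maps n" and "edge_label_poly n f \<noteq> 0"
  then have nd: "nondegenerate n f"
    by (simp add: nondegenerate_if_edge_label_poly_neq_0)
  then show "\<exists>!i. i < n \<and> f i = i" if "\<exists>i<n. f i = i"
    using that unfolding nondegenerate_def by metis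
  fix g assume g: "g \<in> self_maps n" and eq: "edge_label_poly n g = edge_label_poly n f"
  with \<open>edge_label_poly n f \<noteq> 0\<close> have nd': "nondegenerate n g"
    by (simp add: nondegenerate_if_edge_label_poly_neq_0)
  have "f \<in> {..<n} \<rightarrow> {..<n}" "g \<in> {..<n} \<rightarrow> {..<n}"
    using f g by (simp_all add: PiE_def)
  from fixed_point_iff_of_underlying_graph_eq[OF nd nd' this
      underlying_graph_eq_of_edge_label_poly_eq[OF nd nd' this eq]]
  show "(\<exists>i<n. f i = i) \<longleftrightarrow> (\<exists>i<n. g i = i)" .
next
  fix f g
  assume "f \<in> self_maps n" "g \<in> self_maps n" "edge_label_poly n f \<noteq> 0 \<and> (\<exists>i<n. f i = i)"
    and "edge_label_poly n g = edge_label_poly n f"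
  then show "underlying_graph n g = underlying_graph n f"
    by (intro underlying_graph_eq_of_edge_label_poly_eq nondegenerate_if_edge_label_poly_neq_0)
      (auto simp: PiE_def)
next
  fix f c g
  assume f: "f \<in> self_maps n" and g: "g \<in> self_maps n" and "c < n"
    and H: "edge_label_poly n f \<noteq> 0 \<and> f c = c \<and> connected_map n f"
      "edge_label_poly n g = edge_label_poly n f \<and> g c = c"
  have nd: "nondegenerate n f" "nondegenerate n g"
    using H by (auto intro: nondegenerate_if_edge_label_poly_neq_0)
  have "underlying_graph n g = underlying_graph n f"
    using nd f g H by (intro underlying_graph_eq_of_edge_label_poly_eq) (auto simp: PiE_def)
  then show "g = f"
    using eq_of_underlying_graph_eq[OF nd(2) f g] H \<open>c < n\<close> by blast
  then show "functional_digraph n g = functional_digraph n f"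
    by simp
next
  show "edge_label_poly n \<in> rooted_maps n \<rightarrow> rat_mpolys n"
    by (auto simp: rooted_maps_def intro!: edge_label_poly_in_rat_mpolys)
next
  show "inj_on (edge_label_poly n) (rooted_maps n)"
  proof (rule inj_onI)
    fix f g assume fg: "f \<in> rooted_maps n" "g \<in> rooted_maps n"
      and eq: "edge_label_poly n f = edge_label_poly n g"
    note nd = fg[THEN nondegenerate_if_rooted]
    have *: "f \<in> self_maps n" "g \<in> self_maps n" "f 0 = 0" "g 0 = 0" "connected_map n g"
      using fg by (auto simp: rooted_maps_def)
    have "underlying_graph n f = underlying_graph n g"
      using nd * eq by (intro underlying_graph_eq_of_edge_label_poly_eq) (auto simp: PiE_def)
    \<comment> \<open>\<open>n \<ge> 1\<close> makes the common fixed point 0 a vertex.\<close>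
    then show "f = g"
      using eq_of_underlying_graph_eq[of n f g 0] nd * \<open>n \<ge> 1\<close> by simp
  qed
qed

end
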